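(* Let $K$ be a field, let $G$ be a star graph on the vertex set $[3]=\{1,2,3\}$ and let $r\ge 1$ be an integer. Then for every integer $m\ge r+3$ it holds that $$\mathrm{ara}(J_m(G))>\mathrm{ht}(J_m(G))+r.$$
   Context: A star graph on $n$ vertices is the complete bipartite graph $\mathcal{K}_{1,n-1}$. For $n=3$, $R=K[x_{ij}: i\in[m], j\in[3]]$ is the polynomial ring in $3m$ variables over the field $K$, where $[m]=\{1,\dots,m\}$. The generalized binomial edge ideal $J_m(G)\subset R$ is the ideal generated by all $x_{ki}x_{lj}-x_{kj}x_{li}$ with $1\le k<l\le m$ and $\{i,j\}$ an edge of $G$, $i<j$. The arithmetical rank $\mathrm{ara}(I)$ of an ideal $I\subset R$ is the smallest integer $s$ for which there exist $f_1,\dots,f_s\in I$ with $\mathrm{rad}(I)=\mathrm{rad}(f_1,\dots,f_s)$; $\mathrm{ht}$ denotes height. *)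

theory Defs
  imports
    "HOL-Algebra.Ideal"
    "HOL-Library.Poly_Mapping"
    "HOL-Library.Extended_Nat"
    "Graph_Theory.Kuratowski"
begin

section \<open>Polynomial rings in a set of variables\<close>

type_synonym ('v, 'k) mpoly = "('v \<Rightarrow>\<^sub>0 nat) \<Rightarrow>\<^sub>0 'k"

definition mvar :: "'v \<Rightarrow> ('v, 'k::comm_ring_1) mpoly" where
  "mvar v = Poly_Mapping.single (Poly_Mapping.single v 1) 1"

text \<open>The polynomials over \<open>'k\<close> in the variables from \<open>V\<close> only. The height of an ideal depends on
  the ring it lives in, hence the explicit carrier.\<close>

definition mpoly_ring :: "'v set \<Rightarrow> ('v, 'k::comm_ring_1) mpoly ring" where
  "mpoly_ring V =
    \<lparr>carrier = {p. \<forall>t \<in> Poly_Mapping.keys p. Poly_Mapping.keys t \<subseteq> V},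
     monoid.mult = (*), one = 1, zero = 0, add = (+)\<rparr>"

lemma cring_mpoly_ring: "cring (mpoly_ring V :: ('v, 'k::comm_ring_1) mpoly ring)"
proof -
  let ?C = "{p :: ('v, 'k) mpoly. \<forall>t \<in> Poly_Mapping.keys p. Poly_Mapping.keys t \<subseteq> V}"
  have add: "p + q \<in> ?C" if "p \<in> ?C" "q \<in> ?C" for p q
    using that Poly_Mapping.keys_add[of p q] by blast
  have mult: "p * q \<in> ?C" if p: "p \<in> ?C" and q: "q \<in> ?C" for p q
  proof (intro CollectI ballI)
    fix t assume "t \<in> Poly_Mapping.keys (p * q)"
    then obtain a b where "t = a + b" "a \<in> Poly_Mapping.keys p" "b \<in> Poly_Mapping.keys q"
      using Poly_Mapping.keys_mult[of p q] by blast
    with p q show "Poly_Mapping.keys t \<subseteq> V"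
      using Poly_Mapping.keys_add[of a b] by blast
  qed
  have one: "1 \<in> ?C" by simp
  have neg: "\<exists>q\<in>?C. q + p = 0" if "p \<in> ?C" for p
    using that by (intro bexI[of _ "- p"]) auto
  show ?thesis
  proof (intro cringI abelian_groupI comm_monoidI)
    fix x y :: "('v, 'k) mpoly"
    assume "x \<in> carrier (mpoly_ring V)" "y \<in> carrier (mpoly_ring V)"
    then show "x \<oplus>\<^bsub>mpoly_ring V\<^esub> y \<in> carrier (mpoly_ring V)"
      and "x \<otimes>\<^bsub>mpoly_ring V\<^esub> y \<in> carrier (mpoly_ring V)"
      using add[of x y] mult[of x y] by (simp_all add: mpoly_ring_def)
  next
    fix x :: "('v, 'k) mpoly"
    assume "x \<in> carrier (mpoly_ring V)"
    then show "\<exists>y\<in>carrier (mpoly_ring V). y \<oplus>\<^bsub>mpoly_ring V\<^esub> x = \<zero>\<^bsub>mpoly_ring V\<^esub>"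
      using neg[of x] by (simp add: mpoly_ring_def)
  qed (auto simp: mpoly_ring_def algebra_simps)
qed

lemma mvar_in_carrier: "v \<in> V \<Longrightarrow> mvar v \<in> carrier (mpoly_ring V)"
  by (simp add: mvar_def mpoly_ring_def)


section \<open>Radical, height and arithmetical rank\<close>

definition radical :: "('a, 'b) ring_scheme \<Rightarrow> 'a set \<Rightarrow> 'a set" where
  "radical R I = {a \<in> carrier R. \<exists>n::nat. n > 0 \<and> a [^]\<^bsub>R\<^esub> n \<in> I}"

definition prime_chain :: "('a, 'b) ring_scheme \<Rightarrow> nat \<Rightarrow> (nat \<Rightarrow> 'a set) \<Rightarrow> bool" where
  "prime_chain R n P \<longleftrightarrow> (\<forall>i\<le>n. primeideal (P i) R) \<and> (\<forall>i<n. P i \<subset> P (Suc i))"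

text \<open>In a chain \<open>P 0 \<subset> \<dots> \<subset> P n\<close> the length \<open>n\<close> counts the inclusions.\<close>

definition prime_height :: "('a, 'b) ring_scheme \<Rightarrow> 'a set \<Rightarrow> enat" where
  "prime_height R Q = Sup {enat n | n. \<exists>P. prime_chain R n P \<and> P n = Q}"

definition height :: "('a, 'b) ring_scheme \<Rightarrow> 'a set \<Rightarrow> enat" where
  "height R I = Inf {prime_height R Q | Q. primeideal Q R \<and> I \<subseteq> Q}"

text \<open>Only meaningful for ideals that are finitely generated up to radical (e.g. every ideal of a
  Noetherian ring); otherwise \<open>LEAST\<close> ranges over the empty predicate.\<close>

definition ara :: "('a, 'b) ring_scheme \<Rightarrow> 'a set \<Rightarrow> nat" where
  "ara R I = (LEAST s. \<exists>f. (\<forall>i\<in>{1..s}. f i \<in> I) \<and> radical R I = radical R (Idl\<^bsub>R\<^esub> (f ` {1..s})))"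


section \<open>Generalized binomial edge ideals\<close>

text \<open>An undirected graph is represented by its symmetric arc relation: an edge \<open>{i, j}\<close> is the pair
  of arcs \<open>(i, j)\<close> and \<open>(j, i)\<close>. The variable of row \<open>k\<close> and column \<open>i\<close> is \<open>mvar (k, i)\<close>.\<close>

definition star_graph :: "'v pair_pre_digraph \<Rightarrow> bool" where
  "star_graph G \<longleftrightarrow> complete_bipartite_digraph 1 (card (pverts G) - 1) (with_proj G)"

definition gbe_ring :: "nat \<Rightarrow> nat pair_pre_digraph \<Rightarrow> (nat \<times> nat, 'k::field) mpoly ring" where
  "gbe_ring m G = mpoly_ring ({1..m} \<times> pverts G)"

definition gbe_ideal :: "nat \<Rightarrow> nat pair_pre_digraph \<Rightarrow> (nat \<times> nat, 'k::field) mpoly set" where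
  "gbe_ideal m G = Idl\<^bsub>gbe_ring m G\<^esub>
     {mvar (k, i) * mvar (l, j) - mvar (k, j) * mvar (l, i) | k l i j.
        1 \<le> k \<and> k < l \<and> l \<le> m \<and> (i, j) \<in> parcs G \<and> i < j}"

lemma gbe_generator_in_carrier:
  assumes "k \<in> {1..m}" "l \<in> {1..m}" "i \<in> pverts G" "j \<in> pverts G"
  shows "mvar (k, i) * mvar (l, j) - mvar (k, j) * mvar (l, i) \<in> carrier (gbe_ring m G)"
  using assms
  by (auto simp: gbe_ring_def mpoly_ring_def mvar_def mult_single
      dest!: subsetD[OF keys_diff] subsetD[OF Poly_Mapping.keys_add] split: if_splits)

end

theory Submission
  imports Defs "HOL-Library.Product_Lexorder"
begin

text \<open>Let \<open>c\<close> be the center of the star. The ideal \<open>J = J_m(G)\<close> lies in the prime generated by the \<open>m\<close>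
  variables of column \<open>c\<close>, so its height is at most \<open>m\<close>. Near a matrix whose only nonzero entry is in
  column \<open>c\<close>, the variety of \<open>J\<close> consists of the matrices of rank at most one and has codimension
  \<open>2m - 2\<close>; restricting to a transversal slice of dimension \<open>2m - 2\<close> through that matrix turns \<open>J\<close>
  into the ideal of the origin, which needs \<open>2m - 2 > m + r\<close> generators up to radical.

  Both dimension bounds come from counting monomials. A chain of primes of length \<open>n\<close> below a prime
  modulo which \<open>w\<close> variables are independent gives \<open>k ^ (w + n)\<close> linearly independent polynomials
  with exponents \<open>O(k)\<close>. If \<open>s\<close> polynomials generate the ideal of the origin up to radical, their
  products span the ring modulo terms of degree \<open>k\<close> with \<open>O(k ^ s)\<close> elements.\<close>

abbreviation "lookup \<equiv> Poly_Mapping.lookup"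
abbreviation "keys \<equiv> Poly_Mapping.keys"
abbreviation "single \<equiv> Poly_Mapping.single"


section \<open>Counting monomials\<close>

text \<open>Both counting arguments end here. If \<open>a > b\<close>, dividing by
  \<open>k ^ b\<close> would bound \<open>k\<close> by the constant \<open>C * A ^ b\<close>, which
  fails for \<open>k\<close> one larger.\<close>

lemma power_growth_imp_le:
  fixes a b A C :: nat
  assumes "\<And>k. k \<ge> 1 \<Longrightarrow> k ^ a \<le> C * (A * k) ^ b"
  shows "a \<le> b"
proof (rule ccontr)
  assume "\<not> a \<le> b"
  define k where "k = C * A ^ b + 1"
  have "k * k ^ b \<le> k ^ a"
    using \<open>\<not> a \<le> b\<close> by (simp add: k_def power_increasing flip: power_Suc)
  also have "\<dots> \<le> C * (A * k) ^ b"
    by (rule assms) (simp add: k_def)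
  also have "\<dots> = (C * A ^ b) * k ^ b"
    by (simp add: power_mult_distrib)
  finally have "k \<le> C * A ^ b"
    by (simp add: k_def)
  then show False
    by (simp add: k_def)
qed

text \<open>The bound depends on the variable so that the monomials not divisible by any
  \<open>mvar u ^ N u\<close> form a box too, besides the cubes used for counting.\<close>

definition exponent_box :: "'v set \<Rightarrow> ('v \<Rightarrow> nat) \<Rightarrow> ('v \<Rightarrow>\<^sub>0 nat) set" where
  "exponent_box U N = {t. keys t \<subseteq> U \<and> (\<forall>u\<in>U. lookup t u < N u)}"

text \<open>Restriction to \<open>U\<close> makes the exponent functions extensional, so boxes are
  counted as products \<open>PiE\<close>.\<close>

lemma bij_betw_exponent_box:
  assumes "finite U"
  shows "bij_betw (\<lambda>t. restrict (lookup t) U) (exponent_box U N) (PiE U (\<lambda>u. {..<N u}))"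
proof (rule bij_betw_imageI)
  show "inj_on (\<lambda>t. restrict (lookup t) U) (exponent_box U N)"
  proof (rule inj_onI)
    fix s t :: "'a \<Rightarrow>\<^sub>0 nat"
    assume s: "s \<in> exponent_box U N" and t: "t \<in> exponent_box U N"
      and eq: "restrict (lookup s) U = restrict (lookup t) U"
    show "s = t"
    proof (rule poly_mapping_eqI)
      fix v
      show "lookup s v = lookup t v"
      proof (cases "v \<in> U")
        case True
        then show ?thesis using fun_cong[OF eq, of v] by simp
      next
        case False
        then have "v \<notin> keys s" "v \<notin> keys t" using s t by (auto simp: exponent_box_def)
        then show ?thesis by (simp add: in_keys_iff)
      qed
    qed
  qed
  show "(\<lambda>t. restrict (lookup t) U) ` exponent_box U N = PiE U (\<lambda>u. {..<N u})"
  proof (intro equalityI subsetI)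
    fix g assume g: "g \<in> PiE U (\<lambda>u. {..<N u})"
    define t where "t = Abs_poly_mapping (\<lambda>v. if v \<in> U then g v else 0)"
    have look: "lookup t = (\<lambda>v. if v \<in> U then g v else 0)"
      unfolding t_def using assms by (intro lookup_Abs_poly_mapping) simp
    have "keys t \<subseteq> U"
      by (auto simp: in_keys_iff look split: if_splits)
    then have "t \<in> exponent_box U N"
      using g by (auto simp: exponent_box_def look PiE_iff)
    moreover have "restrict (lookup t) U = g"
      using g by (auto simp: look fun_eq_iff PiE_iff extensional_def restrict_def)
    ultimately show "g \<in> (\<lambda>t. restrict (lookup t) U) ` exponent_box U N"
      by blast
  qed (auto simp: exponent_box_def)
qed

lemma finite_exponent_box: "finite U \<Longrightarrow> finite (exponent_box U N)"
  using bij_betw_finite[OF bij_betw_exponent_box, of U N] by (simp add: finite_PiE)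

lemma card_exponent_box: "finite U \<Longrightarrow> card (exponent_box U N) = (\<Prod>u\<in>U. N u)"
  using bij_betw_same_card[OF bij_betw_exponent_box, of U N] by (simp add: card_PiE)


section \<open>Polynomials as a vector space\<close>

definition scale :: "'k \<Rightarrow> ('v, 'k::comm_ring_1) mpoly \<Rightarrow> ('v, 'k) mpoly" where
  "scale c p = single 0 c * p"

lemma lookup_scale: "lookup (scale c p) t = c * lookup p t"
proof -
  have "lookup (scale c p) t = lookup (Poly_Mapping.map ((*) c) p) t"
    by (simp only: scale_def mult_map_scale_conv_mult)
  also have "\<dots> = c * lookup p t"
    by (simp add: Poly_Mapping.map.rep_eq when_def)
  finally show ?thesis .
qed

interpretation mpoly: vector_space "scale :: 'k \<Rightarrow> ('v, 'k::field) mpoly \<Rightarrow> ('v, 'k) mpoly"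
  by unfold_locales
    (auto intro!: poly_mapping_eqI simp: lookup_scale lookup_add algebra_simps)

lemma scale_mult_left: "scale c p * q = scale c (p * q)"
  and scale_mult_right: "p * scale c q = scale c (p * q)"
  by (simp_all add: scale_def ac_simps)

lemma single_eq_scale: "single t c = scale c (single t 1)"
  by (simp add: scale_def mult_single)

lemma mpoly_eq_sum: "p = (\<Sum>t\<in>keys p. single t (lookup p t))"
  by (rule poly_mapping_eqI) (auto simp: lookup_sum lookup_single when_def in_keys_iff)

lemma mpoly_eq_sum_scale: "p = (\<Sum>t\<in>keys p. scale (lookup p t) (single t 1))"
  using mpoly_eq_sum[of p] by (simp flip: single_eq_scale)

lemma in_span_monomials:
  fixes p :: "('v, 'k::field) mpoly"
  assumes "keys p \<subseteq> T"
  shows "p \<in> mpoly.span ((\<lambda>t. single t 1) ` T)"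
proof -
  have "(\<Sum>t\<in>keys p. scale (lookup p t) (single t 1)) \<in> mpoly.span ((\<lambda>t. single t 1) ` T)"
    using assms by (intro mpoly.span_sum mpoly.span_scale mpoly.span_base) auto
  then show ?thesis
    by (simp flip: mpoly_eq_sum_scale)
qed

text \<open>For an ideal \<open>P\<close> and finite \<open>I\<close>, linear independence of the
  images in the quotient by \<open>P\<close>. It concerns an indexed family, so a repetition is a
  dependence and \<open>card I\<close> counts dimensions.\<close>

definition independent_mod ::
    "('v, 'k::field) mpoly set \<Rightarrow> 'i set \<Rightarrow> ('i \<Rightarrow> ('v, 'k) mpoly) \<Rightarrow> bool" where
  "independent_mod P I b \<longleftrightarrow> (\<forall>c. (\<Sum>i\<in>I. scale (c i) (b i)) \<in> P \<longrightarrow> (\<forall>i\<in>I. c i = 0))"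

lemma independent_modD:
  "independent_mod P I b \<Longrightarrow> (\<Sum>i\<in>I. scale (c i) (b i)) \<in> P \<Longrightarrow> i \<in> I \<Longrightarrow> c i = 0"
  unfolding independent_mod_def by blast

lemma independent_mod_reindex:
  assumes "independent_mod P I b" "bij_betw h I' I"
  shows "independent_mod P I' (b \<circ> h)"
  unfolding independent_mod_def
proof (intro allI impI ballI)
  fix c i assume sum: "(\<Sum>i\<in>I'. scale (c i) ((b \<circ> h) i)) \<in> P" and "i \<in> I'"
  define c' where "c' = c \<circ> inv_into I' h"
  have inv: "inv_into I' h (h i) = i" if "i \<in> I'" for i
    using assms(2) that by (simp add: bij_betw_def)
  have "(\<Sum>i\<in>I. scale (c' i) (b i)) = (\<Sum>i\<in>I'. scale (c' (h i)) (b (h i)))"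
    by (rule sum.reindex_bij_betw[OF assms(2), symmetric])
  also have "\<dots> = (\<Sum>i\<in>I'. scale (c i) ((b \<circ> h) i))"
    by (rule sum.cong) (simp_all add: c'_def inv)
  finally have "c' (h i) = 0"
    using sum assms \<open>i \<in> I'\<close> by (intro independent_modD[OF assms(1)]) (auto simp: bij_betw_def)
  then show "c i = 0"
    using \<open>i \<in> I'\<close> by (simp add: c'_def inv)
qed

lemma independent_mod_monomials: "finite T \<Longrightarrow> independent_mod {0} T (\<lambda>t. single t 1)"
  unfolding independent_mod_def
proof (intro allI impI ballI)
  fix c t assume "finite T" "(\<Sum>t\<in>T. scale (c t) (single t 1)) \<in> {0}" "t \<in> T"
  then have "lookup (\<Sum>t\<in>T. scale (c t) (single t 1)) t = 0"
    by simp
  then show "c t = 0"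
    using \<open>finite T\<close> \<open>t \<in> T\<close>
    by (simp add: lookup_sum lookup_scale lookup_single when_def if_distrib cong: if_cong)
qed

text \<open>A relation equal to 0 is a relation modulo \<open>P\<close>, so \<open>b\<close> is
  injective on \<open>I\<close> with linearly independent image, and the exchange bound
  applies.\<close>

lemma independent_mod_card_le:
  assumes "independent_mod P I b" "0 \<in> P" "finite I" "finite T" "b ` I \<subseteq> mpoly.span T"
  shows "card I \<le> card T"
proof -
  have ind: "c i = 0" if "(\<Sum>i\<in>I. scale (c i) (b i)) = 0" "i \<in> I" for c i
    using independent_modD[OF assms(1)] assms(2) that by simp
  have inj: "inj_on b I"
  proof (rule inj_onI, rule ccontr)
    fix i j assume ij: "i \<in> I" "j \<in> I" "b i = b j" "i \<noteq> j"
    \<comment> \<open>Two indices with the same value give the nontrivial relation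
      \<open>b i - b j = 0\<close>.\<close>
    define c :: "_ \<Rightarrow> 'b" where "c l = (if l = i then 1 else if l = j then -1 else 0)" for l
    have "(\<Sum>l\<in>I. scale (c l) (b l)) = (\<Sum>l\<in>{i, j}. scale (c l) (b l))"
      using ij \<open>finite I\<close> by (intro sum.mono_neutral_right) (auto simp: c_def scale_def)
    also have "\<dots> = 0"
      using ij by (simp add: c_def)
    finally have "c i = 0" using ij ind by blast
    then show False by (simp add: c_def)
  qed
  have "mpoly.independent (b ` I)"
    using \<open>finite I\<close> ind[of "\<lambda>i. _ (b i)"]
    by (auto simp: mpoly.dependent_finite sum.reindex[OF inj])
  then have "card (b ` I) \<le> card T"
    using mpoly.independent_span_bound assms by blast
  then show ?thesis
    by (simp add: card_image inj)
qed


section \<open>The polynomial rings and their ideals\<close>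

lemma mpoly_ring_simps [simp]:
  "monoid.mult (mpoly_ring V) = (*)" "one (mpoly_ring V) = 1"
  "zero (mpoly_ring V) = 0" "add (mpoly_ring V) = (+)"
  by (simp_all add: mpoly_ring_def)

lemma mpoly_carrier_iff: "p \<in> carrier (mpoly_ring V) \<longleftrightarrow> (\<forall>t\<in>keys p. keys t \<subseteq> V)"
  by (simp add: mpoly_ring_def)

lemma mpoly_pow [simp]: "p [^]\<^bsub>mpoly_ring V\<^esub> (n::nat) = p ^ n"
  by (induction n) (simp_all add: nat_pow_def mult.commute)

lemma mpoly_carrier_0 [simp]: "0 \<in> carrier (mpoly_ring V)"
  and mpoly_carrier_1 [simp]: "1 \<in> carrier (mpoly_ring V)"
  by (simp_all add: mpoly_ring_def)

lemma mpoly_carrier_add: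
  "p \<in> carrier (mpoly_ring V) \<Longrightarrow> q \<in> carrier (mpoly_ring V) \<Longrightarrow> p + q \<in> carrier (mpoly_ring V)"
  using cring.cring_simprules(1)[OF cring_mpoly_ring] by fastforce

lemma mpoly_carrier_mult:
  "p \<in> carrier (mpoly_ring V) \<Longrightarrow> q \<in> carrier (mpoly_ring V) \<Longrightarrow> p * q \<in> carrier (mpoly_ring V)"
  using cring.cring_simprules(5)[OF cring_mpoly_ring] by fastforce

lemma mpoly_carrier_uminus: "p \<in> carrier (mpoly_ring V) \<Longrightarrow> - p \<in> carrier (mpoly_ring V)"
  by (simp add: mpoly_carrier_iff)

lemma mpoly_carrier_single: "keys t \<subseteq> V \<Longrightarrow> single t c \<in> carrier (mpoly_ring V)"
  by (simp add: mpoly_carrier_iff)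

lemma mpoly_carrier_scale: "p \<in> carrier (mpoly_ring V) \<Longrightarrow> scale c p \<in> carrier (mpoly_ring V)"
  unfolding scale_def by (intro mpoly_carrier_mult mpoly_carrier_single) simp_all

lemma mpoly_carrier_power: "p \<in> carrier (mpoly_ring V) \<Longrightarrow> p ^ n \<in> carrier (mpoly_ring V)"
  by (induction n) (auto intro: mpoly_carrier_mult)

lemma mpoly_carrier_sum:
  "(\<And>i. i \<in> I \<Longrightarrow> f i \<in> carrier (mpoly_ring V)) \<Longrightarrow> sum f I \<in> carrier (mpoly_ring V)"
  by (induction I rule: infinite_finite_induct) (auto intro: mpoly_carrier_add)

lemma mpoly_carrier_prod:
  "(\<And>i. i \<in> I \<Longrightarrow> f i \<in> carrier (mpoly_ring V)) \<Longrightarrow> prod f I \<in> carrier (mpoly_ring V)"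
  by (induction I rule: infinite_finite_induct) (auto intro: mpoly_carrier_mult)

lemmas mpoly_carrier_closed = mpoly_carrier_add mpoly_carrier_mult mpoly_carrier_uminus
  mpoly_carrier_scale mpoly_carrier_power mpoly_carrier_sum mpoly_carrier_prod

text \<open>Negatives arise by multiplication with \<open>- 1\<close>, so closure under them is not
  a premise.\<close>

lemma mpoly_idealI:
  assumes "I \<subseteq> carrier (mpoly_ring V)" "0 \<in> I"
    and add: "\<And>p q. p \<in> I \<Longrightarrow> q \<in> I \<Longrightarrow> p + q \<in> I"
    and mult: "\<And>p q. p \<in> I \<Longrightarrow> q \<in> carrier (mpoly_ring V) \<Longrightarrow> q * p \<in> I"
  shows "ideal I (mpoly_ring V)"
proof -
  interpret cring "mpoly_ring V" by (rule cring_mpoly_ring)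
  have uminus: "- p \<in> I" if "p \<in> I" for p
    using mult[OF that, of "- 1"] by (simp add: mpoly_carrier_uminus)
  show ?thesis
  proof (rule idealI)
    show "subgroup I (add_monoid (mpoly_ring V))"
    proof (rule subgroup.intro)
      fix p assume p: "p \<in> I"
      then have "\<ominus>\<^bsub>mpoly_ring V\<^esub> p = - p"
        using assms(1) mpoly_carrier_uminus by (intro minus_equality) auto
      then show "inv\<^bsub>add_monoid (mpoly_ring V)\<^esub> p \<in> I"
        using uminus[OF p] by (simp add: a_inv_def)
    qed (use assms in auto)
  qed (use mult in \<open>auto simp: ring_axioms mult.commute\<close>)
qed

lemma ideal_mpoly:
  assumes "ideal I (mpoly_ring V)"
  shows ideal_mpoly_subset: "I \<subseteq> carrier (mpoly_ring V)"
    and ideal_mpoly_0: "0 \<in> I"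
    and ideal_mpoly_add: "p \<in> I \<Longrightarrow> q \<in> I \<Longrightarrow> p + q \<in> I"
    and ideal_mpoly_mult: "p \<in> I \<Longrightarrow> q \<in> carrier (mpoly_ring V) \<Longrightarrow> q * p \<in> I"
    and ideal_mpoly_uminus: "p \<in> I \<Longrightarrow> - p \<in> I"
proof -
  interpret ideal I "mpoly_ring V" by fact
  show "I \<subseteq> carrier (mpoly_ring V)" by (rule a_subset)
  show "0 \<in> I" using additive_subgroup.zero_closed[OF is_additive_subgroup] by simp
  show "p + q \<in> I" if "p \<in> I" "q \<in> I"
    using additive_subgroup.a_closed[OF is_additive_subgroup that] by simp
  show mult: "q * p \<in> I" if "p \<in> I" "q \<in> carrier (mpoly_ring V)" for p q
    using I_l_closed[OF that] by simp
  show "- p \<in> I" if "p \<in> I"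
    using mult[OF that, of "- 1"] by (simp add: mpoly_carrier_uminus)
qed

text \<open>The combinations with coefficients from the carrier form an ideal containing every
  \<open>f j\<close>, and the generated ideal is the smallest such ideal.\<close>

lemma in_Idl_image_imp_sum:
  fixes p :: "('v, 'k::comm_ring_1) mpoly"
  assumes "p \<in> Idl\<^bsub>mpoly_ring V\<^esub> (f ` S)" "finite S" "f ` S \<subseteq> carrier (mpoly_ring V)"
  obtains a where "a ` S \<subseteq> carrier (mpoly_ring V)" "p = (\<Sum>i\<in>S. a i * f i)"
proof -
  interpret cring "mpoly_ring V" by (rule cring_mpoly_ring)
  define C :: "('v, 'k) mpoly set" where "C = carrier (mpoly_ring V)"
  define I where "I = {\<Sum>i\<in>S. a i * f i | a. a ` S \<subseteq> C}"
  have "ideal I (mpoly_ring V)"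
  proof (rule mpoly_idealI)
    show "I \<subseteq> carrier (mpoly_ring V)"
      using assms(3) by (auto simp: I_def C_def image_subset_iff intro!: mpoly_carrier_closed)
    show "0 \<in> I"
      unfolding I_def by (intro CollectI exI[of _ "\<lambda>_. 0"]) (auto simp: C_def)
    show "p + q \<in> I" if pI: "p \<in> I" and qI: "q \<in> I" for p q
    proof -
      obtain a where a: "a ` S \<subseteq> C" "p = (\<Sum>i\<in>S. a i * f i)"
        using pI unfolding I_def by blast
      obtain b where b: "b ` S \<subseteq> C" "q = (\<Sum>i\<in>S. b i * f i)"
        using qI unfolding I_def by blast
      show ?thesis
        unfolding I_def using a b
        by (intro CollectI exI[of _ "\<lambda>i. a i + b i"])
          (auto simp: C_def algebra_simps sum.distrib image_subset_iff intro!: mpoly_carrier_add)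
    qed
    show "q * p \<in> I" if pI: "p \<in> I" and q: "q \<in> carrier (mpoly_ring V)" for p q
    proof -
      obtain a where a: "a ` S \<subseteq> C" "p = (\<Sum>i\<in>S. a i * f i)"
        using pI unfolding I_def by blast
      show ?thesis
        unfolding I_def using a q
        by (intro CollectI exI[of _ "\<lambda>i. q * a i"])
          (auto simp: C_def ac_simps sum_distrib_left image_subset_iff intro!: mpoly_carrier_mult)
    qed
  qed
  moreover have "f ` S \<subseteq> I"
  proof
    fix p assume "p \<in> f ` S"
    then obtain j where "j \<in> S" "p = f j" by blast
    \<comment> \<open>Kronecker delta coefficients pick out \<open>f j\<close>.\<close>
    then show "p \<in> I"
      unfolding I_def using assms(2)
      by (intro CollectI exI[of _ "\<lambda>i. if i = j then 1 else 0"])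
        (auto simp: C_def if_distrib if_distribR cong: if_cong)
  qed
  ultimately have "p \<in> I"
    using assms(1) genideal_minimal by blast
  then show ?thesis
    using that unfolding I_def C_def by blast
qed


section \<open>Substitution\<close>

definition monom_subst :: "('v \<Rightarrow> ('w, 'k::comm_ring_1) mpoly) \<Rightarrow> ('v \<Rightarrow>\<^sub>0 nat) \<Rightarrow> ('w, 'k) mpoly" where
  "monom_subst \<sigma> t = (\<Prod>v\<in>keys t. \<sigma> v ^ lookup t v)"

definition mpoly_subst :: "('v \<Rightarrow> ('w, 'k::comm_ring_1) mpoly) \<Rightarrow> ('v, 'k) mpoly \<Rightarrow> ('w, 'k) mpoly" where
  "mpoly_subst \<sigma> p = (\<Sum>t\<in>keys p. scale (lookup p t) (monom_subst \<sigma> t))"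

lemma monom_subst_0 [simp]: "monom_subst \<sigma> 0 = 1"
  by (simp add: monom_subst_def)

lemma monom_subst_add: "monom_subst \<sigma> (s + t) = monom_subst \<sigma> s * monom_subst \<sigma> t"
proof -
  \<comment> \<open>Over a common index set the added factors are zeroth powers, so the three
    products can be compared factor by factor.\<close>
  have sup: "monom_subst \<sigma> r = (\<Prod>v\<in>keys s \<union> keys t. \<sigma> v ^ lookup r v)"
    if "keys r \<subseteq> keys s \<union> keys t" for r
    unfolding monom_subst_def using that
    by (intro prod.mono_neutral_left) (auto simp: in_keys_iff)
  show ?thesis
    by (simp add: sup keys_add lookup_add power_add prod.distrib)
qed

lemma mpoly_subst_0 [simp]: "mpoly_subst \<sigma> 0 = 0"
  by (simp add: mpoly_subst_def)

lemma mpoly_subst_single: "mpoly_subst \<sigma> (single t c) = scale c (monom_subst \<sigma> t)"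
  by (cases "c = 0") (simp_all add: mpoly_subst_def scale_def)

lemma mpoly_subst_1 [simp]: "mpoly_subst \<sigma> 1 = 1"
  using mpoly_subst_single[of \<sigma> 0 1] by (simp add: scale_def)

lemma mpoly_subst_add: "mpoly_subst \<sigma> (p + q) = mpoly_subst \<sigma> p + mpoly_subst \<sigma> q"
  unfolding mpoly_subst_def
  by (rule setsum_keys_plus_distrib) (simp_all add: scale_def single_add algebra_simps)

lemma mpoly_subst_sum: "mpoly_subst \<sigma> (sum f I) = (\<Sum>i\<in>I. mpoly_subst \<sigma> (f i))"
  by (induction I rule: infinite_finite_induct) (simp_all add: mpoly_subst_add)

text \<open>Both factors are expanded into monomials, where \<open>monom_subst_add\<close>
  applies.\<close>

lemma mpoly_subst_mult:
  fixes \<sigma> :: "'v \<Rightarrow> ('w, 'k::comm_ring_1) mpoly"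
  shows "mpoly_subst \<sigma> (p * q) = mpoly_subst \<sigma> p * mpoly_subst \<sigma> q"
proof -
  have scale_scale: "scale (a * b) (x * y) = scale a x * scale b y"
    for a b :: 'k and x y :: "('w, 'k) mpoly"
  proof -
    have "single 0 (a * b) = single 0 a * (single 0 b :: ('w, 'k) mpoly)"
      by (simp add: mult_single)
    then show ?thesis
      by (simp only: scale_def ac_simps)
  qed
  have "p * q = (\<Sum>s\<in>keys p. \<Sum>t\<in>keys q. single (s + t) (lookup p s * lookup q t))"
    by (subst mpoly_eq_sum[of p], subst mpoly_eq_sum[of q])
      (simp add: sum_product mult_single)
  also have "mpoly_subst \<sigma> \<dots> = (\<Sum>s\<in>keys p. \<Sum>t\<in>keys q.
      scale (lookup p s) (monom_subst \<sigma> s) * scale (lookup q t) (monom_subst \<sigma> t))"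
    by (simp add: mpoly_subst_sum mpoly_subst_single monom_subst_add scale_scale)
  finally show ?thesis
    by (simp add: mpoly_subst_def sum_product)
qed

lemma mpoly_subst_uminus: "mpoly_subst \<sigma> (- p) = - mpoly_subst \<sigma> p"
  using mpoly_subst_add[of \<sigma> p "- p"] by (simp add: add_eq_0_iff)

lemma mpoly_subst_diff: "mpoly_subst \<sigma> (p - q) = mpoly_subst \<sigma> p - mpoly_subst \<sigma> q"
  using mpoly_subst_add[of \<sigma> p "- q"] by (simp add: mpoly_subst_uminus)

lemma mpoly_subst_power: "mpoly_subst \<sigma> (p ^ n) = mpoly_subst \<sigma> p ^ n"
  by (induction n) (simp_all add: mpoly_subst_mult)

lemma mpoly_subst_mvar [simp]: "mpoly_subst \<sigma> (mvar v) = \<sigma> v"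
  by (simp add: mvar_def mpoly_subst_single monom_subst_def scale_def)

lemma mpoly_subst_carrier:
  assumes "p \<in> carrier (mpoly_ring V)" "\<And>v. v \<in> V \<Longrightarrow> \<sigma> v \<in> carrier (mpoly_ring W)"
  shows "mpoly_subst \<sigma> p \<in> carrier (mpoly_ring W)"
proof -
  have "\<sigma> v \<in> carrier (mpoly_ring W)" if "t \<in> keys p" "v \<in> keys t" for t v
    using assms that unfolding mpoly_carrier_iff[of p] by blast
  then show ?thesis
    unfolding mpoly_subst_def monom_subst_def by (intro mpoly_carrier_closed)
qed

lemma mvar_power: "mvar v ^ n = single (single v n) 1"
proof (induction n)
  case (Suc n)
  then show ?case
    by (simp add: mvar_def mult_single flip: single_add)
qed simp

lemma monom_subst_mvar: "monom_subst mvar t = (single t 1 :: ('v, 'k::comm_ring_1) mpoly)"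
proof -
  have "(\<Prod>v\<in>A. single (single v (lookup t v)) 1 :: ('v, 'k) mpoly) = single (\<Sum>v\<in>A. single v (lookup t v)) 1"
    for A
    by (induction A rule: infinite_finite_induct) (simp_all add: mult_single)
  moreover have "(\<Sum>v\<in>keys t. single v (lookup t v)) = t"
    by (rule poly_mapping_eqI) (auto simp: lookup_sum lookup_single when_def in_keys_iff)
  ultimately show ?thesis
    by (simp add: monom_subst_def mvar_power)
qed

text \<open>Only the variables that occur matter. Needed later to see that setting the other
  variables to 0 kills no nonzero polynomial over \<open>W\<close>.\<close>

lemma mpoly_subst_id:
  fixes p :: "('v, 'k::comm_ring_1) mpoly"
  assumes "p \<in> carrier (mpoly_ring W)" "\<And>v. v \<in> W \<Longrightarrow> \<sigma> v = mvar v"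
  shows "mpoly_subst \<sigma> p = p"
proof -
  have "monom_subst \<sigma> t = single t 1" if t: "t \<in> keys p" for t
  proof -
    have "\<sigma> v = mvar v" if "v \<in> keys t" for v
      using assms t that unfolding mpoly_carrier_iff by blast
    then show ?thesis
      by (simp add: monom_subst_def flip: monom_subst_mvar)
  qed
  then have "mpoly_subst \<sigma> p = (\<Sum>t\<in>keys p. scale (lookup p t) (single t 1))"
    by (simp add: mpoly_subst_def)
  then show ?thesis
    using mpoly_eq_sum_scale[of p] by simp
qed


section \<open>Chains of prime ideals\<close>

text \<open>The drop in transcendence degree along \<open>P \<subset> Q\<close>, in terms of linear independence only: the
  lowest power of \<open>z\<close> in a relation modulo \<open>P\<close> vanishes modulo \<open>Q\<close>, and \<open>z\<close> can be cancelled
  modulo \<open>P\<close>.\<close>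

lemma independent_mod_mult_powers:
  fixes b :: "'i \<Rightarrow> ('v, 'k::field) mpoly"
  assumes P: "primeideal P (mpoly_ring V)" and Q: "ideal Q (mpoly_ring V)" and "P \<subseteq> Q"
    and z: "z \<in> Q" "z \<notin> P" and "finite I" and b: "b ` I \<subseteq> carrier (mpoly_ring V)"
    and ind: "independent_mod Q I b"
  shows "independent_mod P (I \<times> {..<k}) (\<lambda>(i, j). b i * z ^ j)"
proof (induction k)
  case 0
  then show ?case by (simp add: independent_mod_def)
next
  case (Suc k)
  have zc: "z \<in> carrier (mpoly_ring V)"
    using ideal_mpoly_subset[OF Q] z by blast
  show ?case
    unfolding independent_mod_def
  proof (intro allI impI)
    fix c
    assume "(\<Sum>x\<in>I \<times> {..<Suc k}. scale (c x) (case x of (i, j) \<Rightarrow> b i * z ^ j)) \<in> P"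
    moreover have "(\<Sum>x\<in>I \<times> {..<Suc k}. scale (c x) (case x of (i, j) \<Rightarrow> b i * z ^ j)) =
        (\<Sum>i\<in>I. \<Sum>j<Suc k. scale (c (i, j)) (b i * z ^ j))"
      by (simp add: sum.cartesian_product case_prod_unfold del: sum.lessThan_Suc)
    ultimately have rel: "(\<Sum>i\<in>I. \<Sum>j<Suc k. scale (c (i, j)) (b i * z ^ j)) \<in> P"
      by simp
    \<comment> \<open>The terms with positive power of \<open>z\<close>, after one factor
      \<open>z\<close> is taken out.\<close>
    define rest where "rest = (\<Sum>i\<in>I. \<Sum>j<k. scale (c (i, Suc j)) (b i * z ^ j))"
    have split: "(\<Sum>i\<in>I. \<Sum>j<Suc k. scale (c (i, j)) (b i * z ^ j)) =
        (\<Sum>i\<in>I. scale (c (i, 0)) (b i)) + z * rest"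
      unfolding sum.lessThan_Suc_shift
      by (simp add: rest_def sum.distrib sum_distrib_left scale_mult_right ac_simps)
    have restc: "rest \<in> carrier (mpoly_ring V)"
      unfolding rest_def using b zc by (intro mpoly_carrier_closed) auto
    \<comment> \<open>Modulo \<open>Q\<close> only the terms with \<open>j = 0\<close> remain, and
      the \<open>b i\<close> are independent there.\<close>
    have "- (z * rest) \<in> Q"
      using ideal_mpoly_uminus[OF Q] ideal_mpoly_mult[OF Q z(1) restc] by (simp add: mult.commute)
    then have "(\<Sum>i\<in>I. scale (c (i, 0)) (b i)) \<in> Q"
      using ideal_mpoly_add[OF Q, of "(\<Sum>i\<in>I. scale (c (i, 0)) (b i)) + z * rest" "- (z * rest)"]
        rel split \<open>P \<subseteq> Q\<close> by auto
    then have c0: "c (i, 0) = 0" if "i \<in> I" for i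
      using independent_modD[OF ind, of "\<lambda>i. c (i, 0)"] that by simp
    then have "z * rest \<in> P"
      using rel split by simp
    \<comment> \<open>Primality cancels \<open>z\<close>, and the shorter relation
      \<open>rest\<close> falls under the induction hypothesis.\<close>
    then have "rest \<in> P"
      using primeideal.I_prime[OF P zc restc] z(2) by simp
    moreover have "rest =
        (\<Sum>x\<in>I \<times> {..<k}. scale (c (fst x, Suc (snd x))) (case x of (i, j) \<Rightarrow> b i * z ^ j))"
      by (simp add: rest_def sum.cartesian_product case_prod_unfold)
    ultimately have cS: "c (i, Suc j) = 0" if "i \<in> I" "j < k" for i j
      using independent_modD[OF Suc, of "\<lambda>x. c (fst x, Suc (snd x))" "(i, j)"] that by simp
    show "\<forall>x\<in>I \<times> {..<Suc k}. c x = 0"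
    proof clarify
      fix i j assume "i \<in> I" "j < Suc k"
      then show "c (i, j) = 0"
        using c0 cS by (cases j) auto
    qed
  qed
qed

text \<open>Bounding each exponent separately, not the total degree, places polynomials over
  \<open>V\<close> in the span of a cube \<open>exponent_box\<close>.\<close>

definition exponents_le :: "nat \<Rightarrow> ('v, 'k::zero) mpoly \<Rightarrow> bool" where
  "exponents_le d p \<longleftrightarrow> (\<forall>t\<in>keys p. \<forall>v. lookup t v \<le> d)"

lemma exponents_le_mult:
  assumes "exponents_le d p" "exponents_le e q"
  shows "exponents_le (d + e) (p * q)"
  unfolding exponents_le_def
proof (intro ballI allI)
  fix t v assume "t \<in> keys (p * q)"
  then obtain a b where "t = a + b" "a \<in> keys p" "b \<in> keys q"
    using Poly_Mapping.keys_mult[of p q] by blast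
  then show "lookup t v \<le> d + e"
    using assms by (auto simp: exponents_le_def lookup_add intro: add_mono)
qed

lemma exponents_le_mono: "exponents_le d p \<Longrightarrow> d \<le> e \<Longrightarrow> exponents_le e p"
  unfolding exponents_le_def by (meson order_trans)

lemma exponents_le_power: "exponents_le d p \<Longrightarrow> exponents_le (n * d) (p ^ n)"
proof (induction n)
  case 0
  then show ?case by (simp add: exponents_le_def)
next
  case (Suc n)
  then show ?case using exponents_le_mult[of d p "n * d" "p ^ n"] by simp
qed

lemma finite_exponents_le:
  assumes "finite A"
  shows "\<exists>d. \<forall>p\<in>A. exponents_le d p"
proof -
  have "finite (\<Union>p\<in>A. \<Union>t\<in>keys p. lookup t ` keys t)"
    using assms by simp
  then obtain d where "\<forall>n\<in>(\<Union>p\<in>A. \<Union>t\<in>keys p. lookup t ` keys t). n \<le> d"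
    using finite_nat_set_iff_bounded_le by metis
  then have le: "lookup t v \<le> d" if "p \<in> A" "t \<in> keys p" "v \<in> keys t" for p t v
    using that by blast
  have "lookup t v \<le> d" if "p \<in> A" "t \<in> keys p" for p t v
    using le[OF that, of v] by (cases "v \<in> keys t") (auto simp: in_keys_iff)
  then show ?thesis
    unfolding exponents_le_def by blast
qed

text \<open>In geometric terms, \<open>n \<le> dim V - dim (P n)\<close>: the hypothesis on \<open>W\<close> says that its variables
  are algebraically independent modulo \<open>P n\<close>.\<close>

lemma prime_chain_length_le:
  fixes P :: "nat \<Rightarrow> ('v, 'k::field) mpoly set"
  assumes "finite V" "W \<subseteq> V" and chain: "prime_chain (mpoly_ring V) n P"
    and W: "P n \<inter> carrier (mpoly_ring W) \<subseteq> {0}"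
  shows "card W + n \<le> card V"
proof -
  have prime: "primeideal (P i) (mpoly_ring V)" if "i \<le> n" for i
    using chain that by (simp add: prime_chain_def)
  then have ideal: "ideal (P i) (mpoly_ring V)" if "i \<le> n" for i
    using that by (blast intro: primeideal.axioms(1))
  have "\<forall>i\<in>{..<n}. \<exists>z. z \<in> P (Suc i) \<and> z \<notin> P i"
    using chain by (auto simp: prime_chain_def)
  then obtain z where z: "\<And>i. i < n \<Longrightarrow> z i \<in> P (Suc i)" "\<And>i. i < n \<Longrightarrow> z i \<notin> P i"
    unfolding bchoice_iff by auto
  obtain d where d: "\<And>i. i < n \<Longrightarrow> exponents_le d (z i)"
    using finite_exponents_le[of "z ` {..<n}"] by auto
  have "finite W"
    using \<open>finite V\<close> \<open>W \<subseteq> V\<close> by (rule rev_finite_subset)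
  have "k ^ (card W + n) \<le> 1 * ((n * d + 2) * k) ^ card V" if "k \<ge> 1" for k
  proof -
    \<comment> \<open>Induction down the chain: passing from \<open>P (Suc i)\<close> to
      \<open>P i\<close> multiplies the family by the powers of \<open>z i\<close> below
      \<open>k\<close>. This gains a factor \<open>k\<close> in size and adds at most
      \<open>k * d\<close> to the exponents.\<close>
    have "\<exists>b. independent_mod (P (n - j)) {..<k ^ (card W + j)} b \<and>
        (\<forall>l<k ^ (card W + j). b l \<in> carrier (mpoly_ring V) \<and> exponents_le (k + j * (k * d)) (b l))"
      if "j \<le> n" for j
      using that
    proof (induction j)
      case 0
      \<comment> \<open>At the top stand the monomials in \<open>W\<close> with exponents below
        \<open>k\<close>: their combinations lie in the ring over \<open>W\<close>, which meets
        \<open>P n\<close> only in 0.\<close>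
      define T where "T = exponent_box W (\<lambda>_. k)"
      have T: "finite T" "card T = k ^ card W"
        using \<open>finite W\<close> by (simp_all add: T_def finite_exponent_box card_exponent_box)
      have "independent_mod (P n) T (\<lambda>t. single t 1)"
        unfolding independent_mod_def
      proof (intro allI impI)
        fix c
        assume "(\<Sum>t\<in>T. scale (c t) (single t 1)) \<in> P n"
        moreover have "(\<Sum>t\<in>T. scale (c t) (single t 1)) \<in> carrier (mpoly_ring W)"
          by (intro mpoly_carrier_closed mpoly_carrier_single) (auto simp: T_def exponent_box_def)
        ultimately have "(\<Sum>t\<in>T. scale (c t) (single t 1)) \<in> {0}"
          using W by blast
        then show "\<forall>t\<in>T. c t = 0"
          using independent_modD[OF independent_mod_monomials[OF T(1)]] by blast
      qed
      moreover obtain h where h: "bij_betw h {..<k ^ card W} T"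
        using ex_bij_betw_nat_finite[OF T(1)] T(2) by (auto simp: atLeast0LessThan)
      ultimately have "independent_mod (P n) {..<k ^ card W} ((\<lambda>t. single t 1) \<circ> h)"
        by (rule independent_mod_reindex)
      moreover have "single (h l) 1 \<in> carrier (mpoly_ring V)"
        "exponents_le k (single (h l) 1 :: ('v, 'k) mpoly)" if "l < k ^ card W" for l
      proof -
        have "h l \<in> T"
          using h that by (auto simp: bij_betw_def)
        then have *: "keys (h l) \<subseteq> W" "\<forall>v\<in>W. lookup (h l) v < k"
          by (auto simp: T_def exponent_box_def)
        then show "single (h l) 1 \<in> carrier (mpoly_ring V)"
          using \<open>W \<subseteq> V\<close> by (intro mpoly_carrier_single) blast
        have "lookup (h l) v \<le> k" for v
        proof (cases "v \<in> W")
          case False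
          then have "v \<notin> keys (h l)" using *(1) by blast
          then show ?thesis by (simp add: in_keys_iff)
        qed (use * in \<open>simp add: less_imp_le\<close>)
        then show "exponents_le k (single (h l) 1 :: ('v, 'k) mpoly)"
          by (simp add: exponents_le_def)
      qed
      ultimately show ?case
        by (intro exI[of _ "(\<lambda>t. single t 1) \<circ> h"]) (auto simp: comp_def)
    next
      case (Suc j)
      define i where "i = n - Suc j"
      have i: "i < n" "n - j = Suc i"
        using Suc.prems by (simp_all add: i_def)
      obtain b where b: "independent_mod (P (Suc i)) {..<k ^ (card W + j)} b"
        "\<And>l. l < k ^ (card W + j) \<Longrightarrow> b l \<in> carrier (mpoly_ring V)"
        "\<And>l. l < k ^ (card W + j) \<Longrightarrow> exponents_le (k + j * (k * d)) (b l)"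
        using Suc i by auto
      define L where "L = {..<k ^ (card W + j)} \<times> {..<k}"
      define b' where "b' = (\<lambda>(l, e). b l * z i ^ e)"
      have "independent_mod (P i) L b'"
        unfolding L_def b'_def
      proof (rule independent_mod_mult_powers)
        show "primeideal (P i) (mpoly_ring V)" "ideal (P (Suc i)) (mpoly_ring V)"
          using prime ideal i by auto
        show "P i \<subseteq> P (Suc i)"
          using chain i by (auto simp: prime_chain_def)
      qed (use b z i in auto)
      moreover have "finite L" "card L = k ^ (card W + Suc j)"
        by (simp_all add: L_def)
      then obtain h where h: "bij_betw h {..<k ^ (card W + Suc j)} L"
        using ex_bij_betw_nat_finite[of L] by (auto simp: atLeast0LessThan)
      ultimately have "independent_mod (P i) {..<k ^ (card W + Suc j)} (b' \<circ> h)"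
        by (rule independent_mod_reindex)
      moreover have "(b' \<circ> h) l \<in> carrier (mpoly_ring V) \<and>
          exponents_le (k + Suc j * (k * d)) ((b' \<circ> h) l)"
        if "l < k ^ (card W + Suc j)" for l
      proof -
        have "h l \<in> L"
          using h that by (auto simp: bij_betw_def)
        then obtain l' e where le: "h l = (l', e)" "l' < k ^ (card W + j)" "e < k"
          by (auto simp: L_def)
        have "z i \<in> carrier (mpoly_ring V)"
          using ideal_mpoly_subset[OF ideal, of "Suc i"] z(1) i by auto
        then have "b l' * z i ^ e \<in> carrier (mpoly_ring V)"
          using b le by (intro mpoly_carrier_closed)
        moreover have "exponents_le (k + j * (k * d) + e * d) (b l' * z i ^ e)"
          by (intro exponents_le_mult exponents_le_power b d le i)
        then have "exponents_le (k + Suc j * (k * d)) (b l' * z i ^ e)"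
          by (rule exponents_le_mono) (use le in simp)
        ultimately show ?thesis
          by (simp add: b'_def le)
      qed
      ultimately show ?case
        unfolding i_def by blast
    qed
    from this[of n] obtain b where b: "independent_mod (P 0) {..<k ^ (card W + n)} b"
      "\<And>l. l < k ^ (card W + n) \<Longrightarrow> b l \<in> carrier (mpoly_ring V)"
      "\<And>l. l < k ^ (card W + n) \<Longrightarrow> exponents_le (k + n * (k * d)) (b l)"
      by auto
    \<comment> \<open>The bound in a box is strict and exponents may reach
      \<open>k + n * (k * d)\<close>, hence the summand 2 rather than 1.\<close>
    define T where "T = exponent_box V (\<lambda>_. (n * d + 2) * k)"
    have "card {..<k ^ (card W + n)} \<le> card ((\<lambda>t. single t 1 :: ('v, 'k) mpoly) ` T)"
    proof (rule independent_mod_card_le[OF b(1)])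
      show "0 \<in> P 0"
        using ideal_mpoly_0[OF ideal] by simp
      show "b ` {..<k ^ (card W + n)} \<subseteq> mpoly.span ((\<lambda>t. single t 1) ` T)"
      proof clarify
        fix l assume l: "l < k ^ (card W + n)"
        have "k + n * (k * d) < (n * d + 2) * k"
          using \<open>k \<ge> 1\<close> by (simp add: algebra_simps)
        then have "lookup t v < (n * d + 2) * k" if "t \<in> keys (b l)" for t v
          using b(3)[OF l] that unfolding exponents_le_def by (blast intro: le_less_trans)
        then have "keys (b l) \<subseteq> T"
          using b(2)[OF l] unfolding T_def exponent_box_def mpoly_carrier_iff by blast
        then show "b l \<in> mpoly.span ((\<lambda>t. single t 1) ` T)"
          by (rule in_span_monomials)
      qed
    qed (use \<open>finite V\<close> in \<open>auto simp: T_def finite_exponent_box\<close>)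
    also have "\<dots> \<le> card T"
      using \<open>finite V\<close> by (intro card_image_le) (simp add: T_def finite_exponent_box)
    also have "\<dots> = ((n * d + 2) * k) ^ card V"
      using \<open>finite V\<close> by (simp add: T_def card_exponent_box)
    finally show ?thesis by simp
  qed
  then show ?thesis
    by (rule power_growth_imp_le)
qed

section \<open>Kernels of substitutions and the height bound\<close>

lemma ideal_kernel_subst:
  "ideal {p \<in> carrier (mpoly_ring V). mpoly_subst \<sigma> p = 0} (mpoly_ring V)"
  by (rule mpoly_idealI) (auto simp: mpoly_subst_add mpoly_subst_mult intro: mpoly_carrier_closed)

text \<open>The quotient embeds into a polynomial ring over a field, which is a domain. The linear
  order on \<open>'w\<close> orders the exponents and so gives the polynomial type its instance
  without zero divisors.\<close>

lemma primeideal_kernel_subst: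
  fixes \<sigma> :: "'v \<Rightarrow> ('w::linorder, 'k::field) mpoly"
  shows "primeideal {p \<in> carrier (mpoly_ring V). mpoly_subst \<sigma> p = 0} (mpoly_ring V)"
proof (rule primeidealI[OF ideal_kernel_subst cring_mpoly_ring])
  have "1 \<notin> {p \<in> carrier (mpoly_ring V). mpoly_subst \<sigma> p = 0}"
    by simp
  then show "carrier (mpoly_ring V) \<noteq> {p \<in> carrier (mpoly_ring V). mpoly_subst \<sigma> p = 0}"
    using mpoly_carrier_1 by blast
qed (auto simp: mpoly_subst_mult)

text \<open>The prime witnessing the bound is the kernel of setting the variables in
  \<open>Z\<close> to 0. The remaining variables are algebraically independent modulo it, so no
  chain ending in it is longer than \<open>card Z\<close>.\<close>

lemma height_le_card_variables:
  fixes I :: "('v::linorder, 'k::field) mpoly set"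
  assumes "finite V" "Z \<subseteq> V" "I \<subseteq> carrier (mpoly_ring V)"
    and zero: "\<And>p. p \<in> I \<Longrightarrow> mpoly_subst (\<lambda>v. if v \<in> Z then 0 else mvar v) p = (0 :: ('v, 'k) mpoly)"
  shows "height (mpoly_ring V) I \<le> enat (card Z)"
proof -
  define \<sigma> :: "'v \<Rightarrow> ('v, 'k) mpoly" where "\<sigma> v = (if v \<in> Z then 0 else mvar v)" for v
  define Q where "Q = {p \<in> carrier (mpoly_ring V). mpoly_subst \<sigma> p = 0}"
  have "I \<subseteq> Q"
    using assms(3) zero by (auto simp: Q_def \<sigma>_def[abs_def])
  moreover have "primeideal Q (mpoly_ring V)"
    unfolding Q_def by (rule primeideal_kernel_subst)
  ultimately have "height (mpoly_ring V) I \<le> prime_height (mpoly_ring V) Q"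
    unfolding height_def by (intro Inf_lower) blast
  also have "\<dots> \<le> enat (card Z)"
    unfolding prime_height_def
  proof (rule Sup_least, clarify)
    fix n P assume chain: "prime_chain (mpoly_ring V) n P" and "Q = P n"
    have "Q \<inter> carrier (mpoly_ring (V - Z)) \<subseteq> {0}"
      using mpoly_subst_id[of _ "V - Z" \<sigma>] by (auto simp: Q_def \<sigma>_def)
    then have "card (V - Z) + n \<le> card V"
      using prime_chain_length_le[OF assms(1) _ chain, of "V - Z"] \<open>Q = P n\<close> by blast
    then show "enat n \<le> enat (card Z)"
      using assms(1,2) card_mono[OF assms(1,2)] by (simp add: card_Diff_subset finite_subset)
  qed
  finally show ?thesis .
qed


section \<open>Generators of an ideal supported at the origin\<close>

definition total_degree :: "'v set \<Rightarrow> ('v \<Rightarrow>\<^sub>0 nat) \<Rightarrow> nat" where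
  "total_degree U t = (\<Sum>v\<in>U. lookup t v)"

lemma total_degree_add: "total_degree U (s + t) = total_degree U s + total_degree U t"
  by (simp add: total_degree_def lookup_add sum.distrib)

text \<open>For \<open>p\<close> in the ring over \<open>U\<close>, membership in the \<open>k\<close>-th power of the ideal
  generated by \<open>U\<close>.\<close>

definition order_ge :: "'v set \<Rightarrow> nat \<Rightarrow> ('v, 'k::comm_ring_1) mpoly set" where
  "order_ge U k = {p. \<forall>t\<in>keys p. k \<le> total_degree U t}"

lemma order_ge_0 [simp]: "p \<in> order_ge U 0" "0 \<in> order_ge U k"
  by (simp_all add: order_ge_def)

lemma order_ge_add: "p \<in> order_ge U k \<Longrightarrow> q \<in> order_ge U k \<Longrightarrow> p + q \<in> order_ge U k"
  using Poly_Mapping.keys_add[of p q] by (auto simp: order_ge_def)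

lemma order_ge_sum: "(\<And>i. i \<in> I \<Longrightarrow> f i \<in> order_ge U k) \<Longrightarrow> sum f I \<in> order_ge U k"
  by (induction I rule: infinite_finite_induct) (auto intro: order_ge_add)

lemma order_ge_mult:
  assumes "p \<in> order_ge U j" "q \<in> order_ge U k"
  shows "p * q \<in> order_ge U (j + k)"
proof -
  have "j + k \<le> total_degree U t" if t: "t \<in> keys (p * q)" for t
  proof -
    obtain a b where "t = a + b" "a \<in> keys p" "b \<in> keys q"
      using Poly_Mapping.keys_mult[of p q] t by blast
    then show ?thesis
      using assms by (auto simp: order_ge_def total_degree_add intro: add_mono)
  qed
  then show ?thesis
    by (simp add: order_ge_def)
qed

section \<open>Truncation of polynomials below a given degree\<close>

definition truncate :: "'v set \<Rightarrow> nat \<Rightarrow> ('v, 'k::comm_ring_1) mpoly \<Rightarrow> ('v, 'k) mpoly" where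
  "truncate U D p = Poly_Mapping.mapp (\<lambda>t c. if total_degree U t < D then c else 0) p"

lemma lookup_truncate:
  "lookup (truncate U D p) t = (if total_degree U t < D then lookup p t else 0)"
  by (simp add: truncate_def lookup_mapp when_def in_keys_iff)

lemma truncate_add: "truncate U D (p + q) = truncate U D p + truncate U D q"
  by (rule poly_mapping_eqI) (simp add: lookup_truncate lookup_add)

lemma truncate_scale: "truncate U D (scale c p) = scale c (truncate U D p)"
  by (rule poly_mapping_eqI) (simp add: lookup_truncate lookup_scale)

lemma truncate_eq_0: "p \<in> order_ge U D \<Longrightarrow> truncate U D p = 0"
  by (rule poly_mapping_eqI) (force simp: lookup_truncate order_ge_def in_keys_iff)

lemma truncate_single: "total_degree U t < D \<Longrightarrow> truncate U D (single t c) = single t c"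
  by (rule poly_mapping_eqI) (auto simp: lookup_truncate lookup_single when_def)

text \<open>Truncation is linear, so the polynomials with the claimed property form a subspace
  containing \<open>G\<close>.\<close>

lemma truncate_in_span:
  fixes w :: "('v, 'k::field) mpoly"
  assumes "w \<in> mpoly.span G"
  shows "truncate U D w \<in> mpoly.span (truncate U D ` G)"
proof -
  have "mpoly.subspace {w :: ('v, 'k) mpoly. truncate U D w \<in> mpoly.span (truncate U D ` G)}"
    by (auto simp: mpoly.subspace_def truncate_add truncate_scale truncate_eq_0
        mpoly.span_zero mpoly.span_add mpoly.span_scale)
  then have "mpoly.span G \<subseteq> {w. truncate U D w \<in> mpoly.span (truncate U D ` G)}"
    by (intro mpoly.span_minimal) (auto intro: mpoly.span_base)
  then show ?thesis
    using assms by blast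
qed

lemma mult_in_span:
  fixes w :: "('v, 'k::field) mpoly"
  assumes "w \<in> mpoly.span G" "\<And>g. g \<in> G \<Longrightarrow> p * g \<in> mpoly.span H"
  shows "p * w \<in> mpoly.span H"
proof -
  have "mpoly.subspace {w :: ('v, 'k) mpoly. p * w \<in> mpoly.span H}"
    by (auto simp: mpoly.subspace_def distrib_left scale_mult_right
        mpoly.span_zero mpoly.span_add mpoly.span_scale)
  then have "mpoly.span G \<subseteq> {w. p * w \<in> mpoly.span H}"
    using assms(2) by (intro mpoly.span_minimal) auto
  then show ?thesis
    using assms(1) by blast
qed

text \<open>If the variables have powers in \<open>(f)\<close>, then finitely many monomials \<open>T\<close> span the ring modulo
  \<open>(f)\<close>, hence the products of \<open>T\<close> with fewer than \<open>D\<close> powers of each \<open>f i\<close> span it modulo order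
  \<open>D\<close>. Their number grows like \<open>D ^ card S\<close>, that of the monomials of degree below \<open>D\<close> like
  \<open>D ^ card U\<close>.\<close>

lemma card_variables_le_card_generators:
  fixes f :: "'i \<Rightarrow> ('v, 'k::field) mpoly"
  assumes "finite U" "finite S" and f: "\<And>i. i \<in> S \<Longrightarrow> f i \<in> order_ge U 1"
    and pow: "\<And>u. u \<in> U \<Longrightarrow>
      \<exists>N a. a ` S \<subseteq> carrier (mpoly_ring U) \<and> mvar u ^ N = (\<Sum>i\<in>S. a i * f i)"
  shows "card U \<le> card S"
proof -
  define C :: "('v, 'k) mpoly set" where "C = carrier (mpoly_ring U)"
  obtain N where "\<And>u. u \<in> U \<Longrightarrow> \<exists>a. a ` S \<subseteq> C \<and> mvar u ^ N u = (\<Sum>i\<in>S. a i * f i)"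
    using bchoice[of U "\<lambda>u n. \<exists>a. a ` S \<subseteq> C \<and> mvar u ^ n = (\<Sum>i\<in>S. a i * f i)"] pow
    unfolding C_def by blast
  then obtain a where Na: "\<And>u. u \<in> U \<Longrightarrow> a u ` S \<subseteq> C"
    "\<And>u. u \<in> U \<Longrightarrow> mvar u ^ N u = (\<Sum>i\<in>S. a u i * f i)"
    using bchoice[of U "\<lambda>u a. a ` S \<subseteq> C \<and> mvar u ^ N u = (\<Sum>i\<in>S. a i * f i)"] by blast
  define T where "T = exponent_box U N"
  have T: "finite T"
    using \<open>finite U\<close> by (simp add: T_def finite_exponent_box)
  define M :: "('v, 'k) mpoly set" where "M = (\<lambda>t. single t 1) ` T"

  \<comment> \<open>Being a combination of the finitely many monomials in \<open>T\<close>, modulo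
    combinations of the \<open>f i\<close> with coefficients over \<open>U\<close>.\<close>
  define Good where "Good p \<longleftrightarrow> (\<exists>w b. w \<in> mpoly.span M \<and> b ` S \<subseteq> C \<and> p = w + (\<Sum>i\<in>S. b i * f i))"
    for p
  have good_single: "Good (single t 1)" if t: "keys t \<subseteq> U" for t
  proof (cases "t \<in> T")
    case True
    then show ?thesis
      unfolding Good_def
      by (intro exI[of _ "single t 1"] exI[of _ "\<lambda>_. 0"]) (auto simp: M_def C_def intro: mpoly.span_base)
  next
    case False
    \<comment> \<open>A monomial outside \<open>T\<close> is divisible by some
      \<open>mvar u ^ N u\<close>, which is a combination of the \<open>f i\<close>; its part in the
      span of \<open>M\<close> can be taken to be 0.\<close>
    then obtain u where u: "u \<in> U" "N u \<le> lookup t u"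
      using t by (auto simp: T_def exponent_box_def not_less)
    define s where "s = t - single u (N u)"
    have s: "t = single u (N u) + s"
      using u by (intro poly_mapping_eqI) (auto simp: s_def lookup_add lookup_minus lookup_single when_def)
    have "single t 1 = single s 1 * (mvar u ^ N u :: ('v, 'k) mpoly)"
      by (simp add: mvar_power mult_single s add.commute)
    also have "\<dots> = (\<Sum>i\<in>S. (single s 1 * a u i) * f i)"
      by (simp add: Na(2)[OF u(1)] sum_distrib_left ac_simps)
    finally have eq: "single t 1 = (\<Sum>i\<in>S. (single s 1 * a u i) * f i)" .
    have "keys s \<subseteq> U"
      using t by (auto simp: s_def in_keys_iff lookup_minus)
    then have "(\<lambda>i. single s 1 * a u i) ` S \<subseteq> C"
      using Na(1)[OF u(1)] by (auto simp: C_def intro!: mpoly_carrier_closed mpoly_carrier_single)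
    then show ?thesis
      unfolding Good_def using eq mpoly.span_zero
      by (intro exI[of _ 0] exI[of _ "\<lambda>i. single s 1 * a u i"]) auto
  qed
  have good_scale: "Good (scale c p)" if "Good p" for c p
  proof -
    obtain w b where "w \<in> mpoly.span M" "b ` S \<subseteq> C" "p = w + (\<Sum>i\<in>S. b i * f i)"
      using \<open>Good p\<close> unfolding Good_def by blast
    then show ?thesis
      unfolding Good_def
      by (intro exI[of _ "scale c w"] exI[of _ "\<lambda>i. scale c (b i)"])
        (auto simp: C_def mpoly.scale_right_distrib mpoly.scale_sum_right scale_mult_left
          intro!: mpoly.span_scale mpoly_carrier_scale)
  qed
  have good_add: "Good (p + q)" if "Good p" "Good q" for p q
  proof -
    obtain w b where wb: "w \<in> mpoly.span M" "b ` S \<subseteq> C" "p = w + (\<Sum>i\<in>S. b i * f i)"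
      using \<open>Good p\<close> unfolding Good_def by blast
    obtain w' b' where wb': "w' \<in> mpoly.span M" "b' ` S \<subseteq> C" "q = w' + (\<Sum>i\<in>S. b' i * f i)"
      using \<open>Good q\<close> unfolding Good_def by blast
    show ?thesis
      unfolding Good_def using wb wb'
      by (intro exI[of _ "w + w'"] exI[of _ "\<lambda>i. b i + b' i"])
        (auto simp: C_def distrib_right sum.distrib intro!: mpoly.span_add mpoly_carrier_add)
  qed
  have "Good 0"
    using good_scale[OF good_single, of 0 0] by (simp add: mpoly.scale_zero_left)
  have good: "Good p" if "p \<in> C" for p
  proof -
    have "mpoly.subspace (Collect Good)"
      by (auto simp: mpoly.subspace_def intro: \<open>Good 0\<close> good_add good_scale)
    then have "mpoly.span ((\<lambda>t. single t 1) ` {t. keys t \<subseteq> U}) \<subseteq> Collect Good"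
      by (intro mpoly.span_minimal) (auto intro: good_single)
    moreover have "p \<in> mpoly.span ((\<lambda>t. single t 1) ` {t. keys t \<subseteq> U})"
      using that by (intro in_span_monomials) (auto simp: C_def mpoly_carrier_iff)
    ultimately show ?thesis by blast
  qed

  define G where "G k = (\<lambda>(\<alpha>, t). (\<Prod>i\<in>S. f i ^ \<alpha> i) * single t 1) ` (PiE S (\<lambda>_. {..<k}) \<times> T)"
    for k :: nat
  have finite_G: "finite (G k)" for k
    using T \<open>finite S\<close> by (auto simp: G_def intro!: finite_PiE)
  have card_G: "card (G k) \<le> k ^ card S * card T" for k
  proof -
    have "card (G k) \<le> card (PiE S (\<lambda>_. {..<k}) \<times> T)"
      unfolding G_def using T \<open>finite S\<close> by (intro card_image_le finite_cartesian_product finite_PiE) auto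
    then show ?thesis
      using \<open>finite S\<close> by (simp add: card_cartesian_product card_PiE)
  qed
  have f_G: "f i * g \<in> G (Suc k)" if "i \<in> S" "g \<in> G k" for i g k
  proof -
    obtain \<alpha> t where g: "\<alpha> \<in> PiE S (\<lambda>_. {..<k})" "t \<in> T" "g = (\<Prod>i\<in>S. f i ^ \<alpha> i) * single t 1"
      using \<open>g \<in> G k\<close> unfolding G_def by auto
    define \<beta> where "\<beta> = \<alpha>(i := Suc (\<alpha> i))"
    have "(\<Prod>j\<in>S. f j ^ \<beta> j) = f i * (\<Prod>j\<in>S. f j ^ \<alpha> j)"
      using \<open>i \<in> S\<close> \<open>finite S\<close> by (simp add: \<beta>_def prod.remove[of S i] ac_simps)
    moreover have "\<beta> \<in> PiE S (\<lambda>_. {..<Suc k})"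
      using g(1) \<open>i \<in> S\<close> by (auto simp: \<beta>_def PiE_iff extensional_def less_Suc_eq)
    ultimately show ?thesis
      using g unfolding G_def by (intro image_eqI[of _ _ "(\<beta>, t)"]) (auto simp: mult.assoc)
  qed
  \<comment> \<open>The exponent 0 is below \<open>Suc k\<close> but not below 0, hence the
    successor.\<close>
  have M_G: "M \<subseteq> G (Suc k)" for k
  proof
    fix p assume "p \<in> M"
    then obtain t where "t \<in> T" "p = single t 1"
      by (auto simp: M_def)
    then show "p \<in> G (Suc k)"
      unfolding G_def by (intro image_eqI[of _ _ "(restrict (\<lambda>_. 0) S, t)"]) auto
  qed
  \<comment> \<open>Each round decomposes \<open>p\<close> by \<open>good\<close> and expands the
    coefficients \<open>b i\<close> by the induction hypothesis; the extra factor \<open>f i\<close>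
    raises the order of the remainder by one.\<close>
  have expand: "\<forall>p\<in>C. \<exists>w q. w \<in> mpoly.span (G k) \<and> q \<in> order_ge U k \<and> p = w + q" for k
  proof (induction k)
    case 0
    show ?case
    proof
      fix p
      show "\<exists>w q. w \<in> mpoly.span (G 0) \<and> q \<in> order_ge U 0 \<and> p = w + q"
        by (intro exI[of _ 0] exI[of _ p]) (simp add: mpoly.span_zero)
    qed
  next
    case (Suc k)
    show ?case
    proof
      fix p assume "p \<in> C"
      then obtain v b where v: "v \<in> mpoly.span M" and b: "b ` S \<subseteq> C"
        and p: "p = v + (\<Sum>i\<in>S. b i * f i)"
        using good unfolding Good_def by blast
      have "\<forall>i\<in>S. \<exists>w. w \<in> mpoly.span (G k) \<and> (\<exists>q. q \<in> order_ge U k \<and> b i = w + q)"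
        using Suc b by blast
      then obtain w where w: "\<forall>i\<in>S. w i \<in> mpoly.span (G k) \<and> (\<exists>q. q \<in> order_ge U k \<and> b i = w i + q)"
        by (rule bchoice[THEN exE])
      then have "\<forall>i\<in>S. \<exists>q. q \<in> order_ge U k \<and> b i = w i + q"
        by blast
      then obtain q where q: "\<forall>i\<in>S. q i \<in> order_ge U k \<and> b i = w i + q i"
        by (rule bchoice[THEN exE])
      have wq: "w i \<in> mpoly.span (G k)" "q i \<in> order_ge U k" "b i = w i + q i" if "i \<in> S" for i
        using w q that by blast+
      have "f i * w i \<in> mpoly.span (G (Suc k))" if "i \<in> S" for i
        using wq(1)[OF that] by (rule mult_in_span) (intro mpoly.span_base f_G that)
      moreover have "v \<in> mpoly.span (G (Suc k))"
        using v mpoly.span_mono[OF M_G] by blast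
      ultimately have "v + (\<Sum>i\<in>S. f i * w i) \<in> mpoly.span (G (Suc k))"
        by (intro mpoly.span_add mpoly.span_sum)
      moreover have "(\<Sum>i\<in>S. f i * q i) \<in> order_ge U (Suc k)"
        using order_ge_mult[OF f wq(2)] by (intro order_ge_sum) simp
      moreover have "p = (v + (\<Sum>i\<in>S. f i * w i)) + (\<Sum>i\<in>S. f i * q i)"
        by (simp add: p wq(3) algebra_simps sum.distrib)
      ultimately show "\<exists>w q. w \<in> mpoly.span (G (Suc k)) \<and> q \<in> order_ge U (Suc k) \<and> p = w + q"
        by blast
    qed
  qed

  have "k ^ card U \<le> card T * ((card U + 1) * k) ^ card S" if "k \<ge> 1" for k
  proof -
    \<comment> \<open>Monomials in \<open>E\<close> have total degree at most
      \<open>card U * k\<close>, so truncation at \<open>D\<close> fixes them while it kills the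
      remainder of order \<open>D\<close>.\<close>
    define D where "D = card U * k + 1"
    define E where "E = exponent_box U (\<lambda>_. k)"
    have E: "finite E" "card E = k ^ card U"
      using \<open>finite U\<close> by (simp_all add: E_def finite_exponent_box card_exponent_box)
    have "card E \<le> card (truncate U D ` G D)"
    proof (rule independent_mod_card_le[OF independent_mod_monomials[OF E(1)]])
      show "(\<lambda>t. single t 1) ` E \<subseteq> mpoly.span (truncate U D ` G D)"
      proof clarify
        fix t assume t: "t \<in> E"
        then have "single t 1 \<in> C"
          unfolding C_def by (intro mpoly_carrier_single) (auto simp: E_def exponent_box_def)
        then obtain w q where w: "w \<in> mpoly.span (G D)" and q: "q \<in> order_ge U D"
          and eq: "single t 1 = w + q"
          using expand by blast
        have "total_degree U t \<le> card U * k"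
          using sum_bounded_above[of U "lookup t" k] t
          by (auto simp: total_degree_def E_def exponent_box_def less_imp_le)
        then have "single t 1 = truncate U D (w + q)"
          by (simp add: truncate_single D_def flip: eq)
        then have "single t 1 = truncate U D w"
          by (simp add: truncate_add truncate_eq_0[OF q])
        then show "single t 1 \<in> mpoly.span (truncate U D ` G D)"
          using truncate_in_span[OF w] by simp
      qed
    qed (use E finite_G in auto)
    also have "\<dots> \<le> card (G D)"
      by (intro card_image_le finite_G)
    also have "\<dots> \<le> D ^ card S * card T"
      by (rule card_G)
    \<comment> \<open>As \<open>k \<ge> 1\<close>, the summand 1 in \<open>D\<close> is absorbed by
      one more multiple of \<open>k\<close>.\<close>
    also have "\<dots> \<le> ((card U + 1) * k) ^ card S * card T"
      using \<open>k \<ge> 1\<close> by (intro mult_right_mono power_mono) (auto simp: D_def)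
    finally show ?thesis
      by (simp add: E(2) mult.commute)
  qed
  then show ?thesis
    by (rule power_growth_imp_le)
qed


section \<open>The edge ideal of the star\<close>

text \<open>The center is the only element of the side of size one in the bipartition.\<close>

lemma star_graph_3_center:
  assumes "pverts G = {1, 2, 3 :: nat}" "star_graph G"
  obtains c where "c \<in> {1, 2, 3}"
    "parcs G = {c} \<times> ({1, 2, 3} - {c}) \<union> ({1, 2, 3} - {c}) \<times> {c}"
proof -
  obtain A B where AB: "{1, 2, 3} = A \<union> B" "A \<inter> B = {}" "card A = 1" "parcs G = A \<times> B \<union> B \<times> A"
    using assms unfolding star_graph_def complete_bipartite_digraph_pair_def by auto
  obtain c where c: "A = {c}"
    using AB(3) card_1_singletonE by blast
  then have "c \<in> {1, 2, 3}" "B = {1, 2, 3} - {c}"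
    using AB(1,2) by auto
  then show ?thesis
    using that AB(4) c by blast
qed

text \<open>The finite set \<open>F\<close> is itself a candidate, so the minimum in
  \<open>ara\<close> is taken over a nonempty set and is attained.\<close>

lemma ara_generators:
  assumes "finite F" "F \<subseteq> carrier (mpoly_ring V)"
  obtains f where "\<And>i. i \<in> {1..ara (mpoly_ring V) (Idl\<^bsub>mpoly_ring V\<^esub> F)} \<Longrightarrow> f i \<in> Idl\<^bsub>mpoly_ring V\<^esub> F"
    "radical (mpoly_ring V) (Idl\<^bsub>mpoly_ring V\<^esub> F) =
      radical (mpoly_ring V)
        (Idl\<^bsub>mpoly_ring V\<^esub> (f ` {1..ara (mpoly_ring V) (Idl\<^bsub>mpoly_ring V\<^esub> F)}))"
proof -
  interpret cring "mpoly_ring V" by (rule cring_mpoly_ring)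
  define J where "J = Idl\<^bsub>mpoly_ring V\<^esub> F"
  define P where "P s \<longleftrightarrow> (\<exists>f. (\<forall>i\<in>{1..s}. f i \<in> J) \<and>
      radical (mpoly_ring V) J = radical (mpoly_ring V) (Idl\<^bsub>mpoly_ring V\<^esub> (f ` {1..s})))" for s :: nat
  obtain g where "bij_betw g {1..card F} F"
    using ex_bij_betw_nat_finite_1[OF assms(1)] by blast
  then have g: "g ` {1..card F} = F"
    by (simp add: bij_betw_def)
  moreover have "F \<subseteq> J"
    unfolding J_def using genideal_self[OF assms(2)] .
  ultimately have "P (card F)"
    unfolding P_def by (intro exI[of _ g]) (auto simp: J_def)
  then have "P (ara (mpoly_ring V) J)"
    unfolding ara_def P_def by (rule LeastI)
  then show ?thesis
    using that unfolding P_def J_def by blast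
qed

theorem proposition3p6:
  fixes G :: "nat pair_pre_digraph" and r m :: nat
    and R :: "(nat \<times> nat, 'k::field) mpoly ring"
  assumes "pverts G = {1, 2, 3}" and "star_graph G"
    and "r \<ge> 1" and "m \<ge> r + 3"
    and "R = gbe_ring m G"
  shows "enat (ara R (gbe_ideal m G)) > height R (gbe_ideal m G) + enat r"
proof -
  obtain c where c: "c \<in> {1, 2, 3}"
    and arcs: "parcs G = {c} \<times> ({1, 2, 3} - {c}) \<union> ({1, 2, 3} - {c}) \<times> {c}"
    using star_graph_3_center[OF assms(1,2)] .
  define V :: "(nat \<times> nat) set" where "V = {1..m} \<times> {1, 2, 3}"
  \<comment> \<open>Coordinates of the transversal slice: the \<open>2 * (m - 1)\<close> entries off
    the first row and off the center column.\<close>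
  define U :: "(nat \<times> nat) set" where "U = {2..m} \<times> ({1, 2, 3} - {c})"
  have R: "R = mpoly_ring V"
    using assms(1,5) by (simp add: gbe_ring_def V_def)
  interpret cring R
    unfolding R by (rule cring_mpoly_ring)
  define minor :: "nat \<Rightarrow> nat \<Rightarrow> nat \<Rightarrow> nat \<Rightarrow> (nat \<times> nat, 'k) mpoly" where
    "minor = (\<lambda>k l i j. mvar (k, i) * mvar (l, j) - mvar (k, j) * mvar (l, i))"
  define F where
    "F = {minor k l i j | k l i j. 1 \<le> k \<and> k < l \<and> l \<le> m \<and> (i, j) \<in> parcs G \<and> i < j}"
  have minor_in_F: "minor k l i j \<in> F"
    if "1 \<le> k" "k < l" "l \<le> m" "(i, j) \<in> parcs G" "i < j" for k l i j
    unfolding F_def using that by blast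
  define J where "J = Idl\<^bsub>R\<^esub> F"
  have J: "gbe_ideal m G = J"
    by (simp only: gbe_ideal_def J_def F_def assms(5) minor_def)
  have "F \<subseteq> (\<lambda>(k, l, i, j). minor k l i j) ` ({1..m} \<times> {1..m} \<times> {1, 2, 3} \<times> {1, 2, 3})"
  proof
    fix p assume "p \<in> F"
    then obtain k l i j where "p = minor k l i j" "1 \<le> k" "k < l" "l \<le> m" "(i, j) \<in> parcs G"
      unfolding F_def by blast
    then show "p \<in> (\<lambda>(k, l, i, j). minor k l i j) ` ({1..m} \<times> {1..m} \<times> {1, 2, 3} \<times> {1, 2, 3})"
      using c by (intro image_eqI[of _ _ "(k, l, i, j)"]) (auto simp: arcs)
  qed
  then have "finite F"
    by (rule finite_subset) simp
  have minor_carrier: "minor k l i j \<in> carrier R"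
    if "k \<in> {1..m}" "l \<in> {1..m}" "i \<in> {1, 2, 3}" "j \<in> {1, 2, 3}" for k l i j
    unfolding minor_def assms(5) using gbe_generator_in_carrier[OF that[folded assms(1)]] by simp
  have F_carrier: "F \<subseteq> carrier R"
    unfolding F_def using c by (auto simp: arcs intro!: minor_carrier)
  have ideal_J: "ideal J R"
    unfolding J_def by (rule genideal_ideal[OF F_carrier])
  have J_carrier: "J \<subseteq> carrier R"
    using ideal_mpoly_subset ideal_J unfolding R by blast
  have F_J: "F \<subseteq> J"
    unfolding J_def by (rule genideal_self[OF F_carrier])
  have J_minimal: "J \<subseteq> I" if "ideal I R" "F \<subseteq> I" for I
    unfolding J_def using that by (rule genideal_minimal)

  \<comment> \<open>Every edge contains \<open>c\<close>, so each term of a minor in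
    \<open>F\<close> has a factor from column \<open>c\<close> and vanishes when that column is set
    to 0.\<close>
  have "height R J \<le> enat (card ({1..m} \<times> {c}))"
    unfolding R
  proof (rule height_le_card_variables)
    fix p assume "p \<in> J"
    let ?\<sigma> = "\<lambda>v. if v \<in> {1..m} \<times> {c} then 0 else (mvar v :: (nat \<times> nat, 'k) mpoly)"
    have "J \<subseteq> {p \<in> carrier R. mpoly_subst ?\<sigma> p = 0}"
    proof (rule J_minimal)
      show "ideal {p \<in> carrier R. mpoly_subst ?\<sigma> p = 0} R"
        unfolding R by (rule ideal_kernel_subst)
      have "mpoly_subst ?\<sigma> p = 0" if "p \<in> F" for p
        using that by (auto simp: F_def minor_def arcs mpoly_subst_diff mpoly_subst_mult)
      then show "F \<subseteq> {p \<in> carrier R. mpoly_subst ?\<sigma> p = 0}"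
        using F_carrier by blast
    qed
    then show "mpoly_subst ?\<sigma> p = 0"
      using \<open>p \<in> J\<close> by blast
  qed (use c J_carrier in \<open>auto simp: V_def R\<close>)
  then have height: "height R J \<le> enat m"
    by (simp add: card_cartesian_product)

  \<comment> \<open>The lower bound for the arithmetical rank\<close>
  obtain f where f: "\<And>i. i \<in> {1..ara R J} \<Longrightarrow> f i \<in> J"
    and rad: "radical R J = radical R (Idl\<^bsub>R\<^esub> (f ` {1..ara R J}))"
    using ara_generators[OF \<open>finite F\<close>, of V] F_carrier unfolding J_def R by blast
  \<comment> \<open>Restriction to the affine space of matrices whose first row and column \<open>c\<close> are those of the
    rank one matrix with single nonzero entry \<open>(1, c)\<close>: there \<open>J\<close> becomes the ideal of the
    origin.\<close>
  define \<psi> :: "nat \<times> nat \<Rightarrow> (nat \<times> nat, 'k) mpoly" where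
    "\<psi> v = (if v = (1, c) then 1 else if v \<in> U then mvar v else 0)" for v
  have "finite U"
    by (simp add: U_def)
  have \<psi>_carrier: "mpoly_subst \<psi> p \<in> carrier (mpoly_ring U)" if "p \<in> carrier R" for p
    using that unfolding R by (rule mpoly_subst_carrier) (simp add: \<psi>_def mvar_in_carrier)
  \<comment> \<open>Each term of a generator also has a factor from a column other than
    \<open>c\<close>, which \<open>\<psi>\<close> sends to a variable of \<open>U\<close> or to 0.
    Hence \<open>J\<close> restricts into the ideal of the origin.\<close>
  have J_order: "J \<subseteq> {p \<in> carrier R. mpoly_subst \<psi> p \<in> order_ge U 1}"
  proof (rule J_minimal)
    show "ideal {p \<in> carrier R. mpoly_subst \<psi> p \<in> order_ge U 1} R"
      unfolding R
    proof (rule mpoly_idealI)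
      fix p q :: "(nat \<times> nat, 'k) mpoly"
      assume "p \<in> {p \<in> carrier (mpoly_ring V). mpoly_subst \<psi> p \<in> order_ge U 1}"
        "q \<in> carrier (mpoly_ring V)"
      then show "q * p \<in> {p \<in> carrier (mpoly_ring V). mpoly_subst \<psi> p \<in> order_ge U 1}"
        using order_ge_mult[of "mpoly_subst \<psi> q" U 0 "mpoly_subst \<psi> p" 1]
        by (auto simp: mpoly_subst_mult intro: mpoly_carrier_closed)
    qed (auto simp: mpoly_subst_add intro: mpoly_carrier_closed order_ge_add)
    have "(mvar v :: (nat \<times> nat, 'k) mpoly) \<in> order_ge U 1" if "v \<in> U" for v
      using \<open>finite U\<close> that
      by (simp add: order_ge_def mvar_def total_degree_def lookup_single when_def)
    then have \<psi>: "\<psi> (k, i) \<in> order_ge U 1" if "i \<noteq> c" for k i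
      using that by (simp add: \<psi>_def)
    have left: "p * q \<in> order_ge U 1" if "p \<in> order_ge U 1" for p q :: "(nat \<times> nat, 'k) mpoly"
      using order_ge_mult[OF that, of q 0] by simp
    have "\<psi> (k, i) * \<psi> (l, j) \<in> order_ge U 1" if "(i, j) \<in> parcs G" for k l i j
    proof (cases "i = c")
      case True
      then have "j \<noteq> c" using that by (auto simp: arcs)
      then show ?thesis using left[OF \<psi>, of j l "\<psi> (k, i)"] by (simp add: mult.commute)
    qed (rule left[OF \<psi>])
    moreover have "(j, i) \<in> parcs G" if "(i, j) \<in> parcs G" for i j
      using that by (auto simp: arcs)
    moreover have "p - q \<in> order_ge U 1" if "p \<in> order_ge U 1" "q \<in> order_ge U 1"
      for p q :: "(nat \<times> nat, 'k) mpoly"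
      using order_ge_add[of p U 1 "- q"] that by (simp add: order_ge_def)
    ultimately have "mpoly_subst \<psi> p \<in> order_ge U 1" if "p \<in> F" for p
      using that by (auto simp: F_def minor_def mpoly_subst_diff mpoly_subst_mult)
    then show "F \<subseteq> {p \<in> carrier R. mpoly_subst \<psi> p \<in> order_ge U 1}"
      using F_carrier by blast
  qed
  have "card U \<le> card {1..ara R J}"
  proof (rule card_variables_le_card_generators[OF \<open>finite U\<close>])
    fix i assume "i \<in> {1..ara R J}"
    then show "mpoly_subst \<psi> (f i) \<in> order_ge U 1"
      using f J_order by blast
  next
    fix u assume "u \<in> U"
    then obtain l i where "u = (l, i)" "l \<in> {2..m}" "i \<in> {1, 2, 3} - {c}"
      unfolding U_def by blast
    then have u: "u = (l, i)" "2 \<le> l" "l \<le> m" "i \<in> {1, 2, 3}" "i \<noteq> c"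
      by simp_all
    \<comment> \<open>\<open>F\<close> has only minors with increasing column indices; for
      \<open>i < c\<close> the sign is reversed.\<close>
    have "minor 1 l c i \<in> J"
    proof (cases "c < i")
      case True
      then have "minor 1 l c i \<in> F"
        using u by (intro minor_in_F) (auto simp: arcs)
      then show ?thesis using F_J by blast
    next
      case False
      then have "minor 1 l i c \<in> F"
        using u by (intro minor_in_F) (auto simp: arcs)
      then have "- minor 1 l i c \<in> J"
        using F_J ideal_mpoly_uminus[OF ideal_J[unfolded R]] by blast
      then show ?thesis by (simp add: minor_def algebra_simps)
    qed
    \<comment> \<open>Equality of the radicals puts a power of this minor into the ideal of the
      \<open>f i\<close>.\<close>
    then have "minor 1 l c i \<in> radical R J"
      using J_carrier by (auto simp: radical_def R intro!: exI[of _ "1::nat"])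
    then obtain n where "minor 1 l c i ^ n \<in> Idl\<^bsub>mpoly_ring V\<^esub> (f ` {1..ara R J})"
      unfolding rad by (auto simp: radical_def R)
    then obtain a where a: "a ` {1..ara R J} \<subseteq> carrier R"
      "minor 1 l c i ^ n = (\<Sum>i\<in>{1..ara R J}. a i * f i)"
      unfolding R by (rule in_Idl_image_imp_sum) (use f J_carrier R in auto)
    \<comment> \<open>Of the four entries, \<open>\<psi>\<close> sends \<open>(1, c)\<close> to 1
      and \<open>(l, i)\<close> to \<open>mvar u\<close>, while \<open>(1, i)\<close> and
      \<open>(l, c)\<close> go to 0.\<close>
    have "mpoly_subst \<psi> (minor 1 l c i) = mvar u"
      using u by (simp add: minor_def mpoly_subst_diff mpoly_subst_mult \<psi>_def U_def)
    then have "mvar u ^ n = mpoly_subst \<psi> (minor 1 l c i ^ n)"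
      by (simp only: mpoly_subst_power)
    then have "mvar u ^ n = (\<Sum>i\<in>{1..ara R J}. mpoly_subst \<psi> (a i) * mpoly_subst \<psi> (f i))"
      by (simp only: a(2) mpoly_subst_sum mpoly_subst_mult)
    moreover have "(\<lambda>i. mpoly_subst \<psi> (a i)) ` {1..ara R J} \<subseteq> carrier (mpoly_ring U)"
      using a(1) \<psi>_carrier by auto
    ultimately show "\<exists>N a. a ` {1..ara R J} \<subseteq> carrier (mpoly_ring U) \<and>
        mvar u ^ N = (\<Sum>i\<in>{1..ara R J}. a i * mpoly_subst \<psi> (f i))"
      by blast
  qed simp
  moreover have "card U = (m - 1) * 2"
    using c by (simp add: U_def card_cartesian_product)
  \<comment> \<open>The inequality \<open>2 * (m - 1) > m + r\<close> is exactly
    \<open>m \<ge> r + 3\<close>.\<close>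
  ultimately have "m + r < ara R J"
    using assms(4) by simp
  moreover have "height R J + enat r \<le> enat (m + r)"
    using add_right_mono[OF height, of "enat r"] by simp
  ultimately show ?thesis
    unfolding J by (meson enat_ord_simps(2) le_less_trans)
qed

end
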